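(* Let $M$ and $N$ be objects of an abelian category $\mathcal{A}$. Then: (1) $N$ is $M$-CS-Rickart and $N$ is $M$-$\mathcal{K}$-nonsingular if and only if $N$ is $M$-Rickart. (2) $N$ is dual $M$-CS-Rickart and $M$ is $N$-$\mathcal{T}$-nonsingular if and only if $N$ is dual $M$-Rickart.
   Context: Let $M,N$ be objects of an abelian category. A subobject $K$ of $L$ is essential in $L$ if $K\cap X=0$ implies $X=0$ for every subobject $X$ of $L$; $K$ is superfluous in $L$ if $K+X=L$ implies $X=L$ for every subobject $X$ of $L$. A subobject $L$ of $M$ lies above a direct summand of $M$ if $L$ contains a direct summand $K$ of $M$ such that $L/K$ is superfluous in $M/K$. $N$ is $M$-Rickart if for every morphism $f:M\to N$ the kernel monomorphism $\mathrm{Ker}(f)\to M$ is a section (split monomorphism), i.e. $\mathrm{Ker}(f)$ is a direct summand of $M$; $N$ is dual $M$-Rickart if for every $f:M\to N$ the cokernel epimorphism $N\to\mathrm{Coker}(f)$ is a retraction (split epimorphism), i.e. $\mathrm{Im}(f)$ is a direct summand of $N$. $N$ is $M$-CS-Rickart if for every morphism $f:M\to N$, $\mathrm{Ker}(f)$ is essential in a direct summand of $M$; $N$ is dual $M$-CS-Rickart if for every morphism $f:M\to N$, $\mathrm{Im}(f)$ lies above a direct summand of $N$. $N$ is $M$-$\mathcal{K}$-nonsingular if for every morphism $f:M\to N$, $\mathrm{Ker}(f)$ essential in $M$ implies $f=0$. $M$ is $N$-$\mathcal{T}$-nonsingular if for every morphism $f:M\to N$, $\mathrm{Im}(f)$ superfluous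 in $N$ implies $f=0$. *)

theory Defs
  imports "HOL-Algebra.Group"
begin

section \<open>Abelian categories\<close>

text \<open>
  A category consists of a set of objects and a set of arrows of arbitrary types. In a composite
  \<open>g \<cdot> f\<close> the arrow \<open>f\<close> is applied first, and \<open>g \<cdot> f\<close> is only meaningful when
  \<open>Dom g = Cod f\<close>. The last two fields carry the additive structure of the hom-sets; addition is only
  meaningful for parallel arrows.
\<close>

record ('o, 'a) precat =
  Obj :: "'o set"
  Arr :: "'a set"
  Dom :: "'a \<Rightarrow> 'o"
  Cod :: "'a \<Rightarrow> 'o"
  Id :: "'o \<Rightarrow> 'a"
  Comp :: "'a \<Rightarrow> 'a \<Rightarrow> 'a"  (infixr "\<cdot>\<index>" 70)
  Add :: "'a \<Rightarrow> 'a \<Rightarrow> 'a"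
  Zero :: "'o \<Rightarrow> 'o \<Rightarrow> 'a"

definition Hom :: "('o, 'a, 'b) precat_scheme \<Rightarrow> 'o \<Rightarrow> 'o \<Rightarrow> 'a set" where
  "Hom C A B = {f \<in> Arr C. Dom C f = A \<and> Cod C f = B}"

definition hom_group :: "('o, 'a, 'b) precat_scheme \<Rightarrow> 'o \<Rightarrow> 'o \<Rightarrow> 'a monoid" where
  "hom_group C A B = \<lparr>carrier = Hom C A B, mult = Add C, one = Zero C A B\<rparr>"

locale category =
  fixes C :: "('o, 'a, 'b) precat_scheme" (structure)
  assumes Dom_in_Obj: "f \<in> Arr C \<Longrightarrow> Dom C f \<in> Obj C"
    and Cod_in_Obj: "f \<in> Arr C \<Longrightarrow> Cod C f \<in> Obj C"
    and Id_in_Hom: "A \<in> Obj C \<Longrightarrow> Id C A \<in> Hom C A A"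
    and Comp_in_Hom: "f \<in> Hom C A B \<Longrightarrow> g \<in> Hom C B D \<Longrightarrow> g \<cdot> f \<in> Hom C A D"
    and Comp_assoc: "f \<in> Hom C A B \<Longrightarrow> g \<in> Hom C B D \<Longrightarrow> h \<in> Hom C D E \<Longrightarrow>
      (h \<cdot> g) \<cdot> f = h \<cdot> (g \<cdot> f)"
    and Comp_Id: "f \<in> Hom C A B \<Longrightarrow> f \<cdot> Id C A = f"
    and Id_Comp: "f \<in> Hom C A B \<Longrightarrow> Id C B \<cdot> f = f"

locale preadditive_category = category +
  assumes hom_comm_group: "A \<in> Obj C \<Longrightarrow> B \<in> Obj C \<Longrightarrow> comm_group (hom_group C A B)"
    and Comp_Add: "f \<in> Hom C A B \<Longrightarrow> f' \<in> Hom C A B \<Longrightarrow> g \<in> Hom C B D \<Longrightarrow>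
      g \<cdot> Add C f f' = Add C (g \<cdot> f) (g \<cdot> f')"
    and Add_Comp: "f \<in> Hom C A B \<Longrightarrow> g \<in> Hom C B D \<Longrightarrow> g' \<in> Hom C B D \<Longrightarrow>
      Add C g g' \<cdot> f = Add C (g \<cdot> f) (g' \<cdot> f)"

definition zero_object :: "('o, 'a, 'b) precat_scheme \<Rightarrow> 'o \<Rightarrow> bool" where
  "zero_object C Z \<longleftrightarrow> Z \<in> Obj C \<and>
     (\<forall>A\<in>Obj C. (\<exists>!f. f \<in> Hom C Z A) \<and> (\<exists>!f. f \<in> Hom C A Z))"

definition biproduct ::
  "('o, 'a, 'b) precat_scheme \<Rightarrow> 'o \<Rightarrow> 'o \<Rightarrow> 'o \<Rightarrow> 'a \<Rightarrow> 'a \<Rightarrow> 'a \<Rightarrow> 'a \<Rightarrow> bool" where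
  "biproduct C A B S i\<^sub>1 i\<^sub>2 p\<^sub>1 p\<^sub>2 \<longleftrightarrow>
     i\<^sub>1 \<in> Hom C A S \<and> i\<^sub>2 \<in> Hom C B S \<and> p\<^sub>1 \<in> Hom C S A \<and> p\<^sub>2 \<in> Hom C S B \<and>
     p\<^sub>1 \<cdot>\<^bsub>C\<^esub> i\<^sub>1 = Id C A \<and> p\<^sub>2 \<cdot>\<^bsub>C\<^esub> i\<^sub>2 = Id C B \<and>
     p\<^sub>1 \<cdot>\<^bsub>C\<^esub> i\<^sub>2 = Zero C B A \<and> p\<^sub>2 \<cdot>\<^bsub>C\<^esub> i\<^sub>1 = Zero C A B \<and>
     Add C (i\<^sub>1 \<cdot>\<^bsub>C\<^esub> p\<^sub>1) (i\<^sub>2 \<cdot>\<^bsub>C\<^esub> p\<^sub>2) = Id C S"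

definition monic :: "('o, 'a, 'b) precat_scheme \<Rightarrow> 'a \<Rightarrow> bool" where
  "monic C m \<longleftrightarrow> m \<in> Arr C \<and>
     (\<forall>A. \<forall>g\<in>Hom C A (Dom C m). \<forall>h\<in>Hom C A (Dom C m). m \<cdot>\<^bsub>C\<^esub> g = m \<cdot>\<^bsub>C\<^esub> h \<longrightarrow> g = h)"

definition epic :: "('o, 'a, 'b) precat_scheme \<Rightarrow> 'a \<Rightarrow> bool" where
  "epic C e \<longleftrightarrow> e \<in> Arr C \<and>
     (\<forall>B. \<forall>g\<in>Hom C (Cod C e) B. \<forall>h\<in>Hom C (Cod C e) B. g \<cdot>\<^bsub>C\<^esub> e = h \<cdot>\<^bsub>C\<^esub> e \<longrightarrow> g = h)"

definition is_kernel :: "('o, 'a, 'b) precat_scheme \<Rightarrow> 'a \<Rightarrow> 'a \<Rightarrow> bool" where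
  "is_kernel C f k \<longleftrightarrow> f \<in> Arr C \<and> k \<in> Arr C \<and> Cod C k = Dom C f \<and>
     f \<cdot>\<^bsub>C\<^esub> k = Zero C (Dom C k) (Cod C f) \<and>
     (\<forall>A. \<forall>g\<in>Hom C A (Dom C f). f \<cdot>\<^bsub>C\<^esub> g = Zero C A (Cod C f) \<longrightarrow>
        (\<exists>!h. h \<in> Hom C A (Dom C k) \<and> k \<cdot>\<^bsub>C\<^esub> h = g))"

definition is_cokernel :: "('o, 'a, 'b) precat_scheme \<Rightarrow> 'a \<Rightarrow> 'a \<Rightarrow> bool" where
  "is_cokernel C f c \<longleftrightarrow> f \<in> Arr C \<and> c \<in> Arr C \<and> Dom C c = Cod C f \<and>
     c \<cdot>\<^bsub>C\<^esub> f = Zero C (Dom C f) (Cod C c) \<and>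
     (\<forall>B. \<forall>g\<in>Hom C (Cod C f) B. g \<cdot>\<^bsub>C\<^esub> f = Zero C (Dom C f) B \<longrightarrow>
        (\<exists>!h. h \<in> Hom C (Cod C c) B \<and> h \<cdot>\<^bsub>C\<^esub> c = g))"

locale additive_category = preadditive_category +
  assumes ex_zero_object: "\<exists>Z. zero_object C Z"
    and ex_biproduct: "A \<in> Obj C \<Longrightarrow> B \<in> Obj C \<Longrightarrow>
      \<exists>S i\<^sub>1 i\<^sub>2 p\<^sub>1 p\<^sub>2. biproduct C A B S i\<^sub>1 i\<^sub>2 p\<^sub>1 p\<^sub>2"

locale abelian_category = additive_category +
  assumes ex_kernel: "f \<in> Arr C \<Longrightarrow> \<exists>k. is_kernel C f k"
    and ex_cokernel: "f \<in> Arr C \<Longrightarrow> \<exists>c. is_cokernel C f c"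
    and monic_is_kernel: "monic C m \<Longrightarrow> \<exists>f. is_kernel C f m"
    and epic_is_cokernel: "epic C e \<Longrightarrow> \<exists>f. is_cokernel C f e"

section \<open>Subobjects\<close>

text \<open>
  Subobjects are represented by monomorphisms; every notion below is invariant under replacing a
  monomorphism by an equivalent one. Likewise a kernel, cokernel or image is any arrow with the
  defining property, and the predicates about \<open>Ker(f)\<close>, \<open>Coker(f)\<close>, \<open>Im(f)\<close> quantify over all such
  arrows (they exist in an abelian category and are unique up to isomorphism).
\<close>

definition subobject :: "('o, 'a, 'b) precat_scheme \<Rightarrow> 'o \<Rightarrow> 'a \<Rightarrow> bool" where
  "subobject C L m \<longleftrightarrow> monic C m \<and> Cod C m = L"

definition sub_le :: "('o, 'a, 'b) precat_scheme \<Rightarrow> 'a \<Rightarrow> 'a \<Rightarrow> bool" where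
  "sub_le C k l \<longleftrightarrow> (\<exists>j\<in>Hom C (Dom C k) (Dom C l). l \<cdot>\<^bsub>C\<^esub> j = k)"

definition sub_eq :: "('o, 'a, 'b) precat_scheme \<Rightarrow> 'a \<Rightarrow> 'a \<Rightarrow> bool" where
  "sub_eq C k l \<longleftrightarrow> sub_le C k l \<and> sub_le C l k"

text \<open>\<open>m\<close> represents the intersection (resp. sum) of \<open>k\<close> and \<open>x\<close>, i.e. their meet (resp. join) in the
  lattice of subobjects of \<open>L\<close>.\<close>

definition is_intersection :: "('o, 'a, 'b) precat_scheme \<Rightarrow> 'o \<Rightarrow> 'a \<Rightarrow> 'a \<Rightarrow> 'a \<Rightarrow> bool" where
  "is_intersection C L k x m \<longleftrightarrow> subobject C L m \<and> sub_le C m k \<and> sub_le C m x \<and>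
     (\<forall>z. subobject C L z \<and> sub_le C z k \<and> sub_le C z x \<longrightarrow> sub_le C z m)"

definition is_sum :: "('o, 'a, 'b) precat_scheme \<Rightarrow> 'o \<Rightarrow> 'a \<Rightarrow> 'a \<Rightarrow> 'a \<Rightarrow> bool" where
  "is_sum C L k x m \<longleftrightarrow> subobject C L m \<and> sub_le C k m \<and> sub_le C x m \<and>
     (\<forall>z. subobject C L z \<and> sub_le C k z \<and> sub_le C x z \<longrightarrow> sub_le C m z)"

definition zero_sub :: "('o, 'a, 'b) precat_scheme \<Rightarrow> 'a \<Rightarrow> bool" where
  "zero_sub C m \<longleftrightarrow> zero_object C (Dom C m)"

definition essential :: "('o, 'a, 'b) precat_scheme \<Rightarrow> 'o \<Rightarrow> 'a \<Rightarrow> bool" where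
  "essential C L k \<longleftrightarrow> subobject C L k \<and>
     (\<forall>x. subobject C L x \<and> (\<exists>m. is_intersection C L k x m \<and> zero_sub C m) \<longrightarrow> zero_sub C x)"

definition superfluous :: "('o, 'a, 'b) precat_scheme \<Rightarrow> 'o \<Rightarrow> 'a \<Rightarrow> bool" where
  "superfluous C L k \<longleftrightarrow> subobject C L k \<and>
     (\<forall>x. subobject C L x \<and> (\<exists>m. is_sum C L k x m \<and> sub_eq C m (Id C L)) \<longrightarrow>
        sub_eq C x (Id C L))"

definition is_section :: "('o, 'a, 'b) precat_scheme \<Rightarrow> 'a \<Rightarrow> bool" where
  "is_section C s \<longleftrightarrow> s \<in> Arr C \<and>
     (\<exists>r\<in>Hom C (Cod C s) (Dom C s). r \<cdot>\<^bsub>C\<^esub> s = Id C (Dom C s))"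

definition is_retraction :: "('o, 'a, 'b) precat_scheme \<Rightarrow> 'a \<Rightarrow> bool" where
  "is_retraction C r \<longleftrightarrow> r \<in> Arr C \<and>
     (\<exists>s\<in>Hom C (Cod C r) (Dom C r). r \<cdot>\<^bsub>C\<^esub> s = Id C (Cod C r))"

definition direct_summand :: "('o, 'a, 'b) precat_scheme \<Rightarrow> 'o \<Rightarrow> 'a \<Rightarrow> bool" where
  "direct_summand C M k \<longleftrightarrow> subobject C M k \<and> is_section C k"

text \<open>The image of \<open>f\<close>, as a subobject of its codomain, is the kernel of the cokernel of \<open>f\<close>.\<close>

definition is_image :: "('o, 'a, 'b) precat_scheme \<Rightarrow> 'a \<Rightarrow> 'a \<Rightarrow> bool" where
  "is_image C f m \<longleftrightarrow> (\<exists>c. is_cokernel C f c \<and> is_kernel C c m)"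

definition essential_in_summand :: "('o, 'a, 'b) precat_scheme \<Rightarrow> 'o \<Rightarrow> 'a \<Rightarrow> bool" where
  "essential_in_summand C M l \<longleftrightarrow> subobject C M l \<and>
     (\<exists>d j. direct_summand C M d \<and> j \<in> Hom C (Dom C l) (Dom C d) \<and> d \<cdot>\<^bsub>C\<^esub> j = l \<and>
        essential C (Dom C d) j)"

text \<open>
  Here \<open>k\<close> is the summand \<open>K\<close> of \<open>M\<close>, \<open>j\<close> the inclusion of \<open>K\<close> into \<open>L\<close>, \<open>q\<close> and \<open>p\<close> the projections of
  \<open>L\<close> onto \<open>L/K\<close> and of \<open>M\<close> onto \<open>M/K\<close>, and \<open>u\<close> the induced inclusion of \<open>L/K\<close> into \<open>M/K\<close>.
\<close>

definition lies_above_summand :: "('o, 'a, 'b) precat_scheme \<Rightarrow> 'o \<Rightarrow> 'a \<Rightarrow> bool" where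
  "lies_above_summand C M l \<longleftrightarrow> subobject C M l \<and>
     (\<exists>k j q p u. direct_summand C M k \<and> j \<in> Hom C (Dom C k) (Dom C l) \<and> l \<cdot>\<^bsub>C\<^esub> j = k \<and>
        is_cokernel C j q \<and> is_cokernel C k p \<and>
        u \<in> Hom C (Cod C q) (Cod C p) \<and> u \<cdot>\<^bsub>C\<^esub> q = p \<cdot>\<^bsub>C\<^esub> l \<and>
        superfluous C (Cod C p) u)"

section \<open>Rickart and CS-Rickart objects\<close>

text \<open>In the predicates below the arguments \<open>M\<close> and \<open>N\<close> are always the domain and the codomain of
  the morphisms \<open>f\<close>; thus \<open>rickart C M N\<close> reads ``\<open>N\<close> is \<open>M\<close>-Rickart'', and
  \<open>T_nonsingular C M N\<close> reads ``\<open>M\<close> is \<open>N\<close>-\<open>\<T>\<close>-nonsingular''.\<close>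

definition rickart :: "('o, 'a, 'b) precat_scheme \<Rightarrow> 'o \<Rightarrow> 'o \<Rightarrow> bool" where
  "rickart C M N \<longleftrightarrow> (\<forall>f\<in>Hom C M N. \<forall>k. is_kernel C f k \<longrightarrow> is_section C k)"

definition dual_rickart :: "('o, 'a, 'b) precat_scheme \<Rightarrow> 'o \<Rightarrow> 'o \<Rightarrow> bool" where
  "dual_rickart C M N \<longleftrightarrow> (\<forall>f\<in>Hom C M N. \<forall>c. is_cokernel C f c \<longrightarrow> is_retraction C c)"

definition CS_rickart :: "('o, 'a, 'b) precat_scheme \<Rightarrow> 'o \<Rightarrow> 'o \<Rightarrow> bool" where
  "CS_rickart C M N \<longleftrightarrow> (\<forall>f\<in>Hom C M N. \<forall>k. is_kernel C f k \<longrightarrow> essential_in_summand C M k)"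

definition dual_CS_rickart :: "('o, 'a, 'b) precat_scheme \<Rightarrow> 'o \<Rightarrow> 'o \<Rightarrow> bool" where
  "dual_CS_rickart C M N \<longleftrightarrow> (\<forall>f\<in>Hom C M N. \<forall>m. is_image C f m \<longrightarrow> lies_above_summand C N m)"

definition K_nonsingular :: "('o, 'a, 'b) precat_scheme \<Rightarrow> 'o \<Rightarrow> 'o \<Rightarrow> bool" where
  "K_nonsingular C M N \<longleftrightarrow>
     (\<forall>f\<in>Hom C M N. \<forall>k. is_kernel C f k \<and> essential C M k \<longrightarrow> f = Zero C M N)"

definition T_nonsingular :: "('o, 'a, 'b) precat_scheme \<Rightarrow> 'o \<Rightarrow> 'o \<Rightarrow> bool" where
  "T_nonsingular C M N \<longleftrightarrow>
     (\<forall>f\<in>Hom C M N. \<forall>m. is_image C f m \<and> superfluous C N m \<longrightarrow> f = Zero C M N)"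

end

theory Submission
  imports Defs
begin

text \<open>
  Why the first equivalence holds. Essentiality of a kernel can be read off the arrow: if \<open>k\<close> is the
  kernel of \<open>g\<close>, a subobject \<open>x\<close> meets \<open>k\<close> trivially exactly when \<open>g \<cdot> x\<close> is monic, so \<open>k\<close> is essential
  iff \<open>g\<close> becomes monic only on zero subobjects (\<open>essential_kernel_iff\<close>).

  Suppose that \<open>Ker f\<close> is essential in a summand \<open>d\<close> of \<open>M\<close> with retraction \<open>r\<close>. Then \<open>f \<cdot> d \<cdot> r\<close> has
  essential kernel: if it is monic on \<open>x\<close>, then \<open>r \<cdot> x\<close> is a subobject of \<open>Dom d\<close> on which \<open>f \<cdot> d\<close> is monic,
  and the kernel of \<open>f \<cdot> d\<close> is \<open>Ker f\<close>, now regarded as an essential subobject of \<open>Dom d\<close>. By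
  \<open>\<K>\<close>-nonsingularity \<open>f \<cdot> d \<cdot> r = 0\<close>, so \<open>f\<close> vanishes on \<open>d\<close> and \<open>Ker f\<close> is the summand \<open>d\<close> itself.
  Conversely, a summand is essential in itself; and if a kernel is both a summand and essential, it
  meets its complement trivially, so the complement is zero and \<open>f = 0\<close>.

  The second equivalence is the first one in the opposite category, which is again abelian. Its
  kernels and subobjects are cokernels and quotients in the original category, whereas superfluity
  and lying above a summand are properties of subobjects in the original category, so the
  definitions are not literal mirror images of each other. The bridge is that a
  subobject is determined by its cokernel: the image of \<open>g\<close> is superfluous iff the cokernel of \<open>g\<close> is
  essential in the opposite category (\<open>superfluous_image_iff_essential_opposite\<close>), and the image of
  \<open>f\<close> lies above a direct summand iff the cokernel of \<open>f\<close> is essential in a direct summand in the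
  opposite category (\<open>lies_above_summand_iff_opposite\<close>).
\<close>

section \<open>The opposite category\<close>

definition opposite :: "('o, 'a, 'b) precat_scheme \<Rightarrow> ('o, 'a, 'b) precat_scheme" where
  "opposite C = C\<lparr>Dom := Cod C, Cod := Dom C, Comp := (\<lambda>g f. f \<cdot>\<^bsub>C\<^esub> g), Zero := (\<lambda>A B. Zero C B A)\<rparr>"

lemma opposite_simps [simp]:
  "Obj (opposite C) = Obj C" "Arr (opposite C) = Arr C"
  "Dom (opposite C) = Cod C" "Cod (opposite C) = Dom C"
  "Id (opposite C) = Id C" "Add (opposite C) = Add C"
  "g \<cdot>\<^bsub>opposite C\<^esub> f = f \<cdot>\<^bsub>C\<^esub> g" "Zero (opposite C) A B = Zero C B A"
  by (simp_all add: opposite_def)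

lemma Hom_opposite [simp]: "Hom (opposite C) A B = Hom C B A"
  by (auto simp: Hom_def)

lemma hom_group_opposite [simp]: "hom_group (opposite C) A B = hom_group C B A"
  by (simp add: hom_group_def)

lemma monic_opposite [simp]: "monic (opposite C) = epic C"
  by (simp add: fun_eq_iff monic_def epic_def)

lemma epic_opposite [simp]: "epic (opposite C) = monic C"
  by (simp add: fun_eq_iff monic_def epic_def)

lemma is_kernel_opposite [simp]: "is_kernel (opposite C) = is_cokernel C"
  by (simp add: fun_eq_iff is_kernel_def is_cokernel_def)

lemma is_cokernel_opposite [simp]: "is_cokernel (opposite C) = is_kernel C"
  by (simp add: fun_eq_iff is_kernel_def is_cokernel_def)

lemma zero_object_opposite [simp]: "zero_object (opposite C) = zero_object C"
  by (auto simp: fun_eq_iff zero_object_def)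

lemma is_section_opposite [simp]: "is_section (opposite C) = is_retraction C"
  by (simp add: fun_eq_iff is_section_def is_retraction_def)

lemma is_retraction_opposite [simp]: "is_retraction (opposite C) = is_section C"
  by (simp add: fun_eq_iff is_section_def is_retraction_def)

lemma subobject_opposite [simp]: "subobject (opposite C) L c \<longleftrightarrow> epic C c \<and> Dom C c = L"
  by (simp add: subobject_def)

lemma biproduct_opposite:
  "biproduct (opposite C) A B S p\<^sub>1 p\<^sub>2 i\<^sub>1 i\<^sub>2 \<longleftrightarrow> biproduct C A B S i\<^sub>1 i\<^sub>2 p\<^sub>1 p\<^sub>2"
  by (auto simp: biproduct_def)

lemma essential_in_summand_opposite_iff:
  "essential_in_summand (opposite C) N c \<longleftrightarrow> epic C c \<and> Dom C c = N \<and>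
     (\<exists>d j. epic C d \<and> Dom C d = N \<and> is_retraction C d \<and> j \<in> Hom C (Cod C d) (Cod C c) \<and>
        j \<cdot>\<^bsub>C\<^esub> d = c \<and> essential (opposite C) (Cod C d) j)"
  by (simp add: essential_in_summand_def direct_summand_def conj_assoc)

lemma (in category) category_opposite: "category (opposite C)"
  by unfold_locales
     (simp_all add: Dom_in_Obj Cod_in_Obj Id_in_Hom Comp_in_Hom Comp_Id Id_Comp Comp_assoc)

lemma (in preadditive_category) preadditive_category_opposite: "preadditive_category (opposite C)"
  by (intro preadditive_category.intro category_opposite preadditive_category_axioms.intro)
     (simp_all add: hom_comm_group Comp_Add Add_Comp)

lemma (in abelian_category) abelian_category_opposite: "abelian_category (opposite C)"
proof (intro abelian_category.intro additive_category.intro preadditive_category_opposite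
    additive_category_axioms.intro abelian_category_axioms.intro)
  show "\<exists>Z. zero_object (opposite C) Z"
    using ex_zero_object by simp
  show "\<exists>S i\<^sub>1 i\<^sub>2 p\<^sub>1 p\<^sub>2. biproduct (opposite C) A B S i\<^sub>1 i\<^sub>2 p\<^sub>1 p\<^sub>2"
    if "A \<in> Obj (opposite C)" "B \<in> Obj (opposite C)" for A B
    using ex_biproduct[of A B] that biproduct_opposite[of C A B]
    unfolding opposite_simps by blast
qed (simp_all add: ex_kernel ex_cokernel monic_is_kernel epic_is_cokernel)

section \<open>Monic and epic arrows, sections and retractions\<close>

context category
begin

lemma HomD: "f \<in> Hom C A B \<Longrightarrow> f \<in> Arr C \<and> Dom C f = A \<and> Cod C f = B \<and> A \<in> Obj C \<and> B \<in> Obj C"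
  using Dom_in_Obj Cod_in_Obj by (auto simp: Hom_def)

lemma monicD:
  assumes "monic C m" "m \<in> Hom C A B" "g \<in> Hom C X A" "h \<in> Hom C X A" "m \<cdot> g = m \<cdot> h"
  shows "g = h"
  using assms HomD[OF assms(2)] unfolding monic_def by blast

lemma monic_Id:
  assumes "A \<in> Obj C" shows "monic C (Id C A)"
proof -
  have "g = h" if "g \<in> Hom C X A" "h \<in> Hom C X A" "Id C A \<cdot> g = Id C A \<cdot> h" for X g h
    using that Id_Comp by metis
  then show ?thesis
    using HomD[OF Id_in_Hom[OF assms]] unfolding monic_def by auto
qed

lemma monic_Comp:
  assumes "m \<in> Hom C A B" "n \<in> Hom C B D" "monic C m" "monic C n"
  shows "monic C (n \<cdot> m)"
proof -
  have nm: "n \<cdot> m \<in> Hom C A D" using assms Comp_in_Hom by blast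
  have "g = h" if g: "g \<in> Hom C X A" and h: "h \<in> Hom C X A" and eq: "(n \<cdot> m) \<cdot> g = (n \<cdot> m) \<cdot> h" for X g h
  proof -
    have "n \<cdot> (m \<cdot> g) = n \<cdot> (m \<cdot> h)"
      using eq Comp_assoc[OF g assms(1,2)] Comp_assoc[OF h assms(1,2)] by simp
    then have "m \<cdot> g = m \<cdot> h"
      using monicD[OF assms(4,2)] Comp_in_Hom assms(1) g h by blast
    then show ?thesis using monicD[OF assms(3,1)] g h by blast
  qed
  then show ?thesis using HomD[OF nm] unfolding monic_def by auto
qed

lemma monic_if_Comp_monic:
  assumes "m \<in> Hom C A B" "n \<in> Hom C B D" "monic C (n \<cdot> m)"
  shows "monic C m"
proof -
  have "g = h" if g: "g \<in> Hom C X A" and h: "h \<in> Hom C X A" and eq: "m \<cdot> g = m \<cdot> h" for X g h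
    using monicD[OF assms(3) Comp_in_Hom[OF assms(1,2)] g h]
      eq Comp_assoc[OF g assms(1,2)] Comp_assoc[OF h assms(1,2)] by simp
  then show ?thesis using HomD[OF assms(1)] unfolding monic_def by auto
qed

lemma section_monic:
  assumes "s \<in> Hom C A B" "r \<in> Hom C B A" "r \<cdot> s = Id C A"
  shows "monic C s"
  using monic_if_Comp_monic[OF assms(1,2)] monic_Id HomD[OF assms(1)] assms(3) by auto

lemma retraction_epic:
  assumes "r \<in> Hom C B A" "s \<in> Hom C A B" "r \<cdot> s = Id C A"
  shows "epic C r"
  using category.section_monic[OF category_opposite, of r A B s] assms by simp

lemma is_sectionI:
  "s \<in> Hom C A B \<Longrightarrow> r \<in> Hom C B A \<Longrightarrow> r \<cdot> s = Id C A \<Longrightarrow> is_section C s"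
  unfolding is_section_def by (auto dest: HomD)

lemma is_sectionD:
  assumes "is_section C s" "s \<in> Hom C A B"
  shows "\<exists>r\<in>Hom C B A. r \<cdot> s = Id C A"
  using assms unfolding is_section_def by (auto dest: HomD)

lemma is_retractionD:
  assumes "is_retraction C r" "r \<in> Hom C B A"
  shows "\<exists>s\<in>Hom C A B. r \<cdot> s = Id C A"
  using assms unfolding is_retraction_def by (auto dest: HomD)

lemma subobject_iff: "subobject C L x \<longleftrightarrow> x \<in> Hom C (Dom C x) L \<and> monic C x"
  by (auto simp: subobject_def monic_def Hom_def)

lemma sub_leI: "j \<in> Hom C K L \<Longrightarrow> k \<in> Hom C K X \<Longrightarrow> l \<in> Hom C L X \<Longrightarrow> l \<cdot> j = k \<Longrightarrow> sub_le C k l"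
  unfolding sub_le_def by (auto dest: HomD)

lemma sub_leD:
  assumes "sub_le C k l" "k \<in> Hom C K X" "l \<in> Hom C L X"
  shows "\<exists>j\<in>Hom C K L. l \<cdot> j = k"
  using assms unfolding sub_le_def by (auto dest: HomD)

end

section \<open>Zero arrows and kernels\<close>

context preadditive_category
begin

lemma Zero_in_Hom: "A \<in> Obj C \<Longrightarrow> B \<in> Obj C \<Longrightarrow> Zero C A B \<in> Hom C A B"
  using monoid.one_closed[of "hom_group C A B"] hom_comm_group[of A B]
  by (simp add: comm_group_def comm_monoid_def hom_group_def)

lemma Add_eq_right_iff:
  assumes "d \<in> Hom C A B" "g \<in> Hom C A B"
  shows "Add C d g = g \<longleftrightarrow> d = Zero C A B"
proof -
  interpret G: comm_group "hom_group C A B"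
    using hom_comm_group HomD[OF assms(1)] by blast
  show ?thesis
    using G.r_cancel_one[of g d] G.r_cancel_one' assms by (auto simp: hom_group_def)
qed

lemma Zero_Add: "g \<in> Hom C A B \<Longrightarrow> Add C (Zero C A B) g = g"
  using Add_eq_right_iff Zero_in_Hom HomD by metis

lemma Add_Zero:
  assumes "g \<in> Hom C A B"
  shows "Add C g (Zero C A B) = g"
proof -
  interpret G: comm_group "hom_group C A B"
    using hom_comm_group HomD[OF assms] by blast
  show ?thesis using G.r_one[of g] assms by (simp add: hom_group_def)
qed

text \<open>Subtraction, which turns an equation of parallel arrows into the vanishing of a single arrow.\<close>

lemma ex_difference:
  assumes "f \<in> Hom C A B" "g \<in> Hom C A B"
  shows "\<exists>d\<in>Hom C A B. Add C d g = f"
proof -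
  interpret G: comm_group "hom_group C A B"
    using hom_comm_group HomD[OF assms(1)] by blast
  define d where "d = f \<otimes>\<^bsub>hom_group C A B\<^esub> inv\<^bsub>hom_group C A B\<^esub> g"
  have fg: "f \<in> carrier (hom_group C A B)" "g \<in> carrier (hom_group C A B)"
    using assms by (simp_all add: hom_group_def)
  then have "d \<in> carrier (hom_group C A B)" "d \<otimes>\<^bsub>hom_group C A B\<^esub> g = f"
    by (simp_all add: d_def G.m_assoc)
  then show ?thesis by (auto simp: hom_group_def)
qed

lemma Comp_Zero:
  assumes "g \<in> Hom C B D" "A \<in> Obj C"
  shows "g \<cdot> Zero C A B = Zero C A D"
proof -
  have z: "Zero C A B \<in> Hom C A B" using Zero_in_Hom HomD assms by metis
  have gz: "g \<cdot> Zero C A B \<in> Hom C A D" using Comp_in_Hom z assms by blast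
  show ?thesis
    using Comp_Add[OF z z assms(1)] Zero_Add[OF z] Add_eq_right_iff[OF gz gz] by simp
qed

lemma Zero_Comp:
  assumes "f \<in> Hom C A B" "D \<in> Obj C"
  shows "Zero C B D \<cdot> f = Zero C A D"
  using preadditive_category.Comp_Zero[OF preadditive_category_opposite, of f B A D] assms by simp

lemma monicI:
  assumes m: "m \<in> Hom C A B"
    and *: "\<And>X a. a \<in> Hom C X A \<Longrightarrow> m \<cdot> a = Zero C X B \<Longrightarrow> a = Zero C X A"
  shows "monic C m"
proof -
  have "g = h" if g: "g \<in> Hom C X A" and h: "h \<in> Hom C X A" and eq: "m \<cdot> g = m \<cdot> h" for X g h
  proof -
    obtain d where d: "d \<in> Hom C X A" "Add C d h = g" using ex_difference[OF g h] by blast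
    have "Add C (m \<cdot> d) (m \<cdot> h) = m \<cdot> h" using Comp_Add[OF d(1) h m] d(2) eq by simp
    then have "m \<cdot> d = Zero C X B"
      using Add_eq_right_iff Comp_in_Hom d(1) h m by blast
    then have "d = Zero C X A" using * d by blast
    then show ?thesis using d Zero_Add[OF h] by simp
  qed
  then show ?thesis using HomD[OF m] unfolding monic_def by auto
qed

lemma epicI:
  assumes "e \<in> Hom C A B"
    and "\<And>X a. a \<in> Hom C B X \<Longrightarrow> a \<cdot> e = Zero C A X \<Longrightarrow> a = Zero C B X"
  shows "epic C e"
  using preadditive_category.monicI[OF preadditive_category_opposite, of e B A] assms by simp

lemma monic_Comp_eq_Zero:
  assumes "monic C m" "m \<in> Hom C A B" "a \<in> Hom C X A" "m \<cdot> a = Zero C X B"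
  shows "a = Zero C X A"
  using monicD[OF assms(1-3)] Zero_in_Hom Comp_Zero[OF assms(2)] HomD[OF assms(3)] assms(4) by metis

lemma epic_Comp_eq_Zero:
  assumes "epic C e" "e \<in> Hom C A B" "a \<in> Hom C B X" "a \<cdot> e = Zero C A X"
  shows "a = Zero C B X"
  using preadditive_category.monic_Comp_eq_Zero[OF preadditive_category_opposite, of e B A a X] assms
  by simp

lemma zero_object_iff: "zero_object C Z \<longleftrightarrow> Z \<in> Obj C \<and> Id C Z = Zero C Z Z"
proof
  assume "zero_object C Z"
  then show "Z \<in> Obj C \<and> Id C Z = Zero C Z Z"
    unfolding zero_object_def using Id_in_Hom Zero_in_Hom by blast
next
  assume Z: "Z \<in> Obj C \<and> Id C Z = Zero C Z Z"
  have "f = Zero C Z A" if "f \<in> Hom C Z A" for f A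
    using Comp_Id[OF that] Comp_Zero[OF that] Z by simp
  moreover have "f = Zero C A Z" if "f \<in> Hom C A Z" for f A
    using Id_Comp[OF that] Zero_Comp[OF that] Z by simp
  ultimately show "zero_object C Z"
    unfolding zero_object_def using Z Zero_in_Hom by metis
qed

lemma from_zero_object:
  assumes "zero_object C Z" "f \<in> Hom C Z A"
  shows "f = Zero C Z A"
  using assms Zero_in_Hom HomD[OF assms(2)] unfolding zero_object_def by blast

lemma to_zero_object:
  assumes "zero_object C Z" "f \<in> Hom C A Z"
  shows "f = Zero C A Z"
  using assms Zero_in_Hom HomD[OF assms(2)] unfolding zero_object_def by blast

lemma monic_Zero_iff:
  assumes "A \<in> Obj C" "B \<in> Obj C"
  shows "monic C (Zero C A B) \<longleftrightarrow> zero_object C A"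
proof
  assume "monic C (Zero C A B)"
  then show "zero_object C A"
    using monic_Comp_eq_Zero[OF _ Zero_in_Hom[OF assms] Id_in_Hom[OF assms(1)]]
      Comp_Id[OF Zero_in_Hom[OF assms]] assms zero_object_iff by simp
next
  assume "zero_object C A"
  then show "monic C (Zero C A B)"
    using monicI[OF Zero_in_Hom[OF assms]] to_zero_object by blast
qed

lemma epic_Zero_iff:
  assumes "A \<in> Obj C" "B \<in> Obj C"
  shows "epic C (Zero C A B) \<longleftrightarrow> zero_object C B"
  using preadditive_category.monic_Zero_iff[OF preadditive_category_opposite, of B A] assms by simp

lemma kernel_in_Hom: "is_kernel C f k \<Longrightarrow> f \<in> Hom C A B \<Longrightarrow> k \<in> Hom C (Dom C k) A"
  by (auto simp: is_kernel_def Hom_def)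

lemma kernel_Comp: "is_kernel C f k \<Longrightarrow> f \<in> Hom C A B \<Longrightarrow> f \<cdot> k = Zero C (Dom C k) B"
  by (auto simp: is_kernel_def Hom_def)

lemma kernel_lift:
  assumes "is_kernel C f k" "f \<in> Hom C A B" "g \<in> Hom C X A" "f \<cdot> g = Zero C X B"
  shows "\<exists>h\<in>Hom C X (Dom C k). k \<cdot> h = g"
  using assms HomD[OF assms(2)] unfolding is_kernel_def by blast

lemma kernel_monic:
  assumes k: "is_kernel C f k"
  shows "monic C k"
proof -
  define A B where "A = Dom C f" and "B = Cod C f"
  have f: "f \<in> Hom C A B" using k by (simp add: is_kernel_def Hom_def A_def B_def)
  note kH = kernel_in_Hom[OF k f]
  show ?thesis
  proof (rule monicI[OF kH])
    fix X a assume a: "a \<in> Hom C X (Dom C k)" and "k \<cdot> a = Zero C X A"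
    moreover have z: "Zero C X (Dom C k) \<in> Hom C X (Dom C k)"
      using Zero_in_Hom HomD[OF a] by blast
    moreover have "k \<cdot> Zero C X (Dom C k) = Zero C X A"
      using Comp_Zero[OF kH] HomD[OF a] by blast
    moreover have "Zero C X A \<in> Hom C X A" "f \<cdot> Zero C X A = Zero C X B"
      using Zero_in_Hom HomD[OF a] HomD[OF f] Comp_Zero[OF f] by auto
    ultimately show "a = Zero C X (Dom C k)"
      using k unfolding is_kernel_def A_def B_def by blast
  qed
qed

lemma kernel_subobject: "is_kernel C f k \<Longrightarrow> f \<in> Hom C A B \<Longrightarrow> subobject C A k"
  using kernel_in_Hom kernel_monic subobject_iff by blast

lemma is_kernelI:
  assumes f: "f \<in> Hom C A B" and k: "k \<in> Hom C K A" and m: "monic C k" and z: "f \<cdot> k = Zero C K B"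
    and *: "\<And>X g. g \<in> Hom C X A \<Longrightarrow> f \<cdot> g = Zero C X B \<Longrightarrow> \<exists>h\<in>Hom C X K. k \<cdot> h = g"
  shows "is_kernel C f k"
  unfolding is_kernel_def
proof (intro conjI allI ballI impI)
  show "f \<in> Arr C" "k \<in> Arr C" "Cod C k = Dom C f" using HomD f k by auto
  show "f \<cdot> k = Zero C (Dom C k) (Cod C f)" using z HomD f k by auto
  fix X g assume "g \<in> Hom C X (Dom C f)" "f \<cdot> g = Zero C X (Cod C f)"
  then have "\<exists>h\<in>Hom C X K. k \<cdot> h = g" using * HomD[OF f] by auto
  then show "\<exists>!h. h \<in> Hom C X (Dom C k) \<and> k \<cdot> h = g"
    using monicD[OF m k] HomD[OF k] by auto
qed

text \<open>Read in the opposite category, the facts on kernels become facts on cokernels.\<close>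

lemmas cokernel_in_Hom = preadditive_category.kernel_in_Hom[OF preadditive_category_opposite, simplified]
lemmas cokernel_Comp = preadditive_category.kernel_Comp[OF preadditive_category_opposite, simplified]
lemmas cokernel_desc = preadditive_category.kernel_lift[OF preadditive_category_opposite, simplified]
lemmas cokernel_epic = preadditive_category.kernel_monic[OF preadditive_category_opposite, simplified]

text \<open>If \<open>Ker f\<close> is contained in a subobject \<open>d\<close>, then restricting \<open>f\<close> to \<open>d\<close> does not change the
  kernel: an arrow killed by \<open>f \<cdot> d\<close> becomes, after composition with \<open>d\<close>, an arrow killed by \<open>f\<close>, and \<open>d\<close>
  can be cancelled afterwards.\<close>

lemma kernel_through_monic:
  assumes f: "f \<in> Hom C A B" and d: "d \<in> Hom C D A" and j: "j \<in> Hom C K D"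
    and k: "is_kernel C f (d \<cdot> j)" and m: "monic C d"
  shows "is_kernel C (f \<cdot> d) j"
proof (rule is_kernelI[OF Comp_in_Hom[OF d f] j])
  have dj: "d \<cdot> j \<in> Hom C K A" using Comp_in_Hom j d by blast
  have Dk: "Dom C (d \<cdot> j) = K" using HomD[OF dj] by blast
  show "monic C j" using monic_if_Comp_monic[OF j d kernel_monic[OF k]] .
  show "(f \<cdot> d) \<cdot> j = Zero C K B"
    using kernel_Comp[OF k f] Dk Comp_assoc[OF j d f] by simp
  fix X g assume g: "g \<in> Hom C X D" and "(f \<cdot> d) \<cdot> g = Zero C X B"
  then have "f \<cdot> (d \<cdot> g) = Zero C X B" using Comp_assoc[OF g d f] by simp
  then obtain h where h: "h \<in> Hom C X K" "(d \<cdot> j) \<cdot> h = d \<cdot> g"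
    using kernel_lift[OF k f Comp_in_Hom[OF g d]] Dk by metis
  then have "d \<cdot> (j \<cdot> h) = d \<cdot> g" using Comp_assoc[OF h(1) j d] by simp
  then have "j \<cdot> h = g" using monicD[OF m d Comp_in_Hom[OF h(1) j] g] by blast
  then show "\<exists>h\<in>Hom C X K. j \<cdot> h = g" using h by blast
qed

text \<open>If \<open>d \<cdot> s = 1\<close>, then \<open>1 - s \<cdot> d\<close> is killed by \<open>d\<close>, so it factors through the kernel \<open>k\<close>; the
  factor is a retraction of \<open>k\<close>, because \<open>1 - s \<cdot> d\<close> is the identity on \<open>k\<close>.\<close>

lemma kernel_of_retraction_is_section:
  assumes d: "d \<in> Hom C A D" "is_retraction C d" and k: "is_kernel C d k"
  shows "is_section C k"
proof -
  obtain s where s: "s \<in> Hom C D A" "d \<cdot> s = Id C D" using is_retractionD d by blast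
  define K where "K = Dom C k"
  have kH: "k \<in> Hom C K A" using kernel_in_Hom[OF k d(1)] by (simp add: K_def)
  have sd: "s \<cdot> d \<in> Hom C A A" using Comp_in_Hom s d by blast
  have A: "A \<in> Obj C" using HomD d by blast
  \<comment> \<open>\<open>e\<close> is the projection \<open>1 - s \<cdot> d\<close> complementary to \<open>s \<cdot> d\<close>.\<close>
  obtain e where e: "e \<in> Hom C A A" "Add C e (s \<cdot> d) = Id C A"
    using ex_difference[OF Id_in_Hom[OF A] sd] by blast
  have "d \<cdot> (s \<cdot> d) = d"
    using Comp_assoc[OF d(1) s(1) d(1)] s(2) Id_Comp[OF d(1)] by simp
  then have "Add C (d \<cdot> e) d = d"
    using Comp_Add[OF e(1) sd d(1)] e(2) Comp_Id[OF d(1)] by simp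
  then have "d \<cdot> e = Zero C A D" using Add_eq_right_iff[OF Comp_in_Hom[OF e(1) d(1)] d(1)] by simp
  then obtain r where r: "r \<in> Hom C A K" "k \<cdot> r = e"
    using kernel_lift[OF k d(1) e(1), folded K_def] by blast
  have "(s \<cdot> d) \<cdot> k = Zero C K A"
    using Comp_assoc[OF kH d(1) s(1)] kernel_Comp[OF k d(1), folded K_def] Comp_Zero[OF s(1)] HomD[OF kH]
    by simp
  then have "Add C (e \<cdot> k) (Zero C K A) = k"
    using Add_Comp[OF kH e(1) sd] e(2) Id_Comp[OF kH] by simp
  then have "e \<cdot> k = k" using Add_Zero[OF Comp_in_Hom[OF kH e(1)]] by simp
  then have "k \<cdot> (r \<cdot> k) = k \<cdot> Id C K"
    using Comp_assoc[OF kH r(1) kH] r(2) Comp_Id[OF kH] by simp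
  then have "r \<cdot> k = Id C K"
    using monicD[OF kernel_monic[OF k] kH Comp_in_Hom[OF kH r(1)]] Id_in_Hom HomD[OF kH] by blast
  then show ?thesis using is_sectionI[OF kH r(1)] by blast
qed

lemmas cokernel_through_epic =
  preadditive_category.kernel_through_monic[OF preadditive_category_opposite, simplified]
lemmas cokernel_of_section_is_retraction =
  preadditive_category.kernel_of_retraction_is_section[OF preadditive_category_opposite, simplified]

end

section \<open>Essential kernels and superfluous images\<close>

context abelian_category
begin

text \<open>A monic arrow is the kernel of some \<open>f\<close>. Since \<open>f\<close> kills \<open>m\<close>, it factors through the cokernel \<open>c\<close>
  of \<open>m\<close>; hence everything killed by \<open>c\<close> is killed by \<open>f\<close> and lifts along \<open>m\<close>.\<close>

lemma monic_is_kernel_of_cokernel: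
  assumes m: "monic C m" "m \<in> Hom C A B" and c: "is_cokernel C m c"
  shows "is_kernel C c m"
proof -
  obtain f where f: "is_kernel C f m" using monic_is_kernel[OF m(1)] by blast
  define D where "D = Cod C f"
  have fH: "f \<in> Hom C B D"
    using f HomD[OF m(2)] unfolding is_kernel_def D_def by (auto simp: Hom_def)
  have Dm: "Dom C m = A" using HomD[OF m(2)] by blast
  note cH = cokernel_in_Hom[OF c m(2)]
  have "f \<cdot> m = Zero C A D" using kernel_Comp[OF f fH] Dm by simp
  then obtain w where w: "w \<in> Hom C (Cod C c) D" "w \<cdot> c = f"
    using cokernel_desc[OF c m(2) fH] by blast
  show ?thesis
  proof (rule is_kernelI[OF cH m(2,1) cokernel_Comp[OF c m(2)]])
    fix X g assume g: "g \<in> Hom C X B" and z: "c \<cdot> g = Zero C X (Cod C c)"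
    have "f \<cdot> g = w \<cdot> (c \<cdot> g)" using Comp_assoc[OF g cH w(1)] w(2) by simp
    also have "\<dots> = Zero C X D" using z Comp_Zero[OF w(1)] HomD[OF g] by simp
    finally obtain h where "h \<in> Hom C X (Dom C m)" "m \<cdot> h = g"
      using kernel_lift[OF f fH g] by blast
    then show "\<exists>h\<in>Hom C X A. m \<cdot> h = g" using Dm by blast
  qed
qed

lemmas epic_is_cokernel_of_kernel =
  abelian_category.monic_is_kernel_of_cokernel[OF abelian_category_opposite, simplified]

text \<open>The part of \<open>x\<close> on which \<open>g\<close> vanishes is the intersection of \<open>x\<close> with \<open>k\<close>. So if the
  intersection is zero, then \<open>g \<cdot> x\<close> has zero kernel, and if \<open>g \<cdot> x\<close> is monic, then anything contained in
  both \<open>x\<close> and \<open>k\<close> is zero.\<close>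

lemma zero_intersection_kernel_iff:
  assumes g: "g \<in> Hom C L P" and k: "is_kernel C g k" and x: "x \<in> Hom C X L" "monic C x"
  shows "(\<exists>m. is_intersection C L k x m \<and> zero_sub C m) \<longleftrightarrow> monic C (g \<cdot> x)"
proof
  have kH: "k \<in> Hom C (Dom C k) L" using kernel_in_Hom[OF k g] .
  have gx: "g \<cdot> x \<in> Hom C X P" using Comp_in_Hom x g by blast
  have sx: "subobject C L x" using x HomD[OF x(1)] subobject_iff by auto
  {
    assume "\<exists>m. is_intersection C L k x m \<and> zero_sub C m"
    then obtain m where m: "is_intersection C L k x m" "zero_object C (Dom C m)"
      unfolding zero_sub_def by blast
    then have mH: "m \<in> Hom C (Dom C m) L" unfolding is_intersection_def subobject_iff by blast
    obtain y where y: "is_kernel C (g \<cdot> x) y" using ex_kernel HomD[OF gx] by blast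
    define Y where "Y = Dom C y"
    have yH: "y \<in> Hom C Y X" using kernel_in_Hom[OF y gx] Y_def by simp
    have xy: "x \<cdot> y \<in> Hom C Y L" using Comp_in_Hom yH x by blast
    have YO: "Y \<in> Obj C" using HomD[OF yH] by blast
    have "g \<cdot> (x \<cdot> y) = Zero C Y P"
      using kernel_Comp[OF y gx] Comp_assoc[OF yH x(1) g] Y_def by simp
    then have "sub_le C (x \<cdot> y) k"
      using kernel_lift[OF k g xy] sub_leI[OF _ xy kH] by metis
    moreover have "sub_le C (x \<cdot> y) x" using sub_leI[OF yH xy x(1)] by blast
    moreover have "subobject C L (x \<cdot> y)"
      using monic_Comp[OF yH x(1) kernel_monic[OF y] x(2)] xy HomD[OF xy] subobject_iff by auto
    ultimately have "sub_le C (x \<cdot> y) m" using m(1) unfolding is_intersection_def by blast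
    then obtain h where h: "h \<in> Hom C Y (Dom C m)" "m \<cdot> h = x \<cdot> y" using sub_leD[OF _ xy mH] by blast
    have "x \<cdot> y = Zero C Y L"
      using h to_zero_object[OF m(2) h(1)] Comp_Zero[OF mH YO] by simp
    then have y0: "y = Zero C Y X" using monic_Comp_eq_Zero[OF x(2,1) yH] by blast
    show "monic C (g \<cdot> x)"
    proof (rule monicI[OF gx])
      fix W a assume a: "a \<in> Hom C W X" "(g \<cdot> x) \<cdot> a = Zero C W P"
      then obtain b where b: "b \<in> Hom C W Y" "y \<cdot> b = a" using kernel_lift[OF y gx a, folded Y_def] by blast
      then show "a = Zero C W X" using y0 Zero_Comp[OF b(1)] HomD[OF yH] by simp
    qed
  }
  assume mo: "monic C (g \<cdot> x)"
  obtain Z where Z: "zero_object C Z" using ex_zero_object by blast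
  then have ZO: "Z \<in> Obj C" using zero_object_iff by blast
  have LO: "L \<in> Obj C" "X \<in> Obj C" "Dom C k \<in> Obj C" using HomD g x kH by blast+
  define m where "m = Zero C Z L"
  have mH: "m \<in> Hom C Z L" using Zero_in_Hom ZO LO m_def by simp
  have "is_intersection C L k x m"
    unfolding is_intersection_def
  proof (intro conjI allI impI)
    show "subobject C L m"
      using monic_Zero_iff[OF ZO LO(1)] Z mH HomD[OF mH] unfolding subobject_def m_def by auto
    show "sub_le C m k"
      using sub_leI[OF Zero_in_Hom[OF ZO LO(3)] mH kH] Comp_Zero[OF kH ZO] m_def by simp
    show "sub_le C m x"
      using sub_leI[OF Zero_in_Hom[OF ZO LO(2)] mH x(1)] Comp_Zero[OF x(1) ZO] m_def by simp
    fix z assume "subobject C L z \<and> sub_le C z k \<and> sub_le C z x"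
    then have zH: "z \<in> Hom C (Dom C z) L" and zk: "sub_le C z k" and zx: "sub_le C z x"
      using subobject_iff by auto
    obtain a where a: "a \<in> Hom C (Dom C z) (Dom C k)" "k \<cdot> a = z" using sub_leD[OF zk zH kH] by blast
    obtain b where b: "b \<in> Hom C (Dom C z) X" "x \<cdot> b = z" using sub_leD[OF zx zH x(1)] by blast
    have DO: "Dom C z \<in> Obj C" using HomD[OF zH] by blast
    have "(g \<cdot> x) \<cdot> b = (g \<cdot> k) \<cdot> a"
      using Comp_assoc[OF b(1) x(1) g] Comp_assoc[OF a(1) kH g] a b by simp
    also have "\<dots> = Zero C (Dom C z) P"
      using kernel_Comp[OF k g] Zero_Comp[OF a(1)] HomD[OF g] by simp
    finally have "b = Zero C (Dom C z) X" using monic_Comp_eq_Zero[OF mo gx b(1)] by blast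
    then have "z = Zero C (Dom C z) L" using b Comp_Zero[OF x(1) DO] by simp
    then show "sub_le C z m"
      using sub_leI[OF Zero_in_Hom[OF DO ZO] zH mH] Comp_Zero[OF mH DO] by simp
  qed
  then show "\<exists>m. is_intersection C L k x m \<and> zero_sub C m"
    using Z HomD[OF mH] unfolding zero_sub_def by auto
qed

lemma essential_kernel_iff:
  assumes g: "g \<in> Hom C L P" and k: "is_kernel C g k"
  shows "essential C L k \<longleftrightarrow>
    (\<forall>X. \<forall>x\<in>Hom C X L. monic C x \<and> monic C (g \<cdot> x) \<longrightarrow> zero_object C X)"
proof -
  have "essential C L k \<longleftrightarrow>
    (\<forall>x. subobject C L x \<and> monic C (g \<cdot> x) \<longrightarrow> zero_object C (Dom C x))"
    unfolding essential_def zero_sub_def[of C x for x]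
    using zero_intersection_kernel_iff[OF g k, unfolded zero_sub_def] kernel_subobject[OF k g]
    unfolding subobject_iff by blast
  also have "\<dots> \<longleftrightarrow> (\<forall>X. \<forall>x\<in>Hom C X L. monic C x \<and> monic C (g \<cdot> x) \<longrightarrow> zero_object C X)"
    unfolding subobject_iff using HomD by metis
  finally show ?thesis .
qed

text \<open>The subobjects above \<open>x\<close> are the kernels of arrows \<open>a \<cdot> e\<close>, and such a kernel contains \<open>u\<close> iff \<open>a\<close>
  kills \<open>e \<cdot> u\<close>. So the only subobject above both \<open>u\<close> and \<open>x\<close> is the whole of \<open>L\<close> iff \<open>e \<cdot> u\<close> is cancellable
  on the right.\<close>

lemma sum_top_iff:
  assumes u: "u \<in> Hom C U L" and x: "x \<in> Hom C X L" "monic C x" and e: "is_cokernel C x e"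
  shows "(\<exists>m. is_sum C L u x m \<and> sub_eq C m (Id C L)) \<longleftrightarrow> epic C (e \<cdot> u)"
proof
  define E where "E = Cod C e"
  have eH: "e \<in> Hom C L E" using cokernel_in_Hom[OF e x(1)] E_def by simp
  have ex: "e \<cdot> x = Zero C X E" using cokernel_Comp[OF e x(1)] E_def by simp
  have eu: "e \<cdot> u \<in> Hom C U E" using Comp_in_Hom u eH by blast
  have LO: "L \<in> Obj C" using HomD[OF u] by blast
  note I = Id_in_Hom[OF LO]
  {
    assume "\<exists>m. is_sum C L u x m \<and> sub_eq C m (Id C L)"
    then obtain m where m: "is_sum C L u x m" "sub_eq C m (Id C L)" by blast
    then have mH: "m \<in> Hom C (Dom C m) L" unfolding is_sum_def subobject_iff by blast
    obtain i where i: "i \<in> Hom C L (Dom C m)" "m \<cdot> i = Id C L"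
      using m(2) sub_leD[OF _ I mH] unfolding sub_eq_def by blast
    show "epic C (e \<cdot> u)"
    proof (rule epicI[OF eu])
      fix Y a assume a: "a \<in> Hom C E Y" "a \<cdot> (e \<cdot> u) = Zero C U Y"
      have ae: "a \<cdot> e \<in> Hom C L Y" using Comp_in_Hom eH a by blast
      obtain z where z: "is_kernel C (a \<cdot> e) z" using ex_kernel HomD[OF ae] by blast
      note zH = kernel_in_Hom[OF z ae]
      have "(a \<cdot> e) \<cdot> u = Zero C U Y" using a Comp_assoc[OF u eH a(1)] by simp
      then have "sub_le C u z"
        using kernel_lift[OF z ae u] sub_leI[OF _ u zH] by metis
      moreover have "(a \<cdot> e) \<cdot> x = Zero C X Y"
        using Comp_assoc[OF x(1) eH a(1)] ex Comp_Zero[OF a(1)] HomD[OF x(1)] by simp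
      then have "sub_le C x z"
        using kernel_lift[OF z ae x(1)] sub_leI[OF _ x(1) zH] by metis
      ultimately have "sub_le C m z"
        using m(1) kernel_subobject[OF z ae] unfolding is_sum_def by blast
      then obtain h where h: "h \<in> Hom C (Dom C m) (Dom C z)" "z \<cdot> h = m"
        using sub_leD[OF _ mH zH] by blast
      have hi: "h \<cdot> i \<in> Hom C L (Dom C z)" using Comp_in_Hom h i by blast
      have "z \<cdot> (h \<cdot> i) = Id C L" using Comp_assoc[OF i(1) h(1) zH] h i by simp
      then have "a \<cdot> e = ((a \<cdot> e) \<cdot> z) \<cdot> (h \<cdot> i)"
        using Comp_assoc[OF hi zH ae] Comp_Id[OF ae] by simp
      also have "\<dots> = Zero C L Y"
        using kernel_Comp[OF z ae] Zero_Comp[OF hi] HomD[OF ae] by simp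
      finally show "a = Zero C E Y"
        using epic_Comp_eq_Zero[OF cokernel_epic[OF e] eH a(1)] by blast
    qed
  }
  assume ep: "epic C (e \<cdot> u)"
  have "is_sum C L u x (Id C L)"
    unfolding is_sum_def
  proof (intro conjI allI impI)
    show "subobject C L (Id C L)"
      using monic_Id[OF LO] HomD[OF I] unfolding subobject_def by blast
    show "sub_le C u (Id C L)" using sub_leI[OF u u I Id_Comp[OF u]] .
    show "sub_le C x (Id C L)" using sub_leI[OF x(1) x(1) I Id_Comp[OF x(1)]] .
    fix z assume "subobject C L z \<and> sub_le C u z \<and> sub_le C x z"
    then have zH: "z \<in> Hom C (Dom C z) L" and zm: "monic C z"
      and uz: "sub_le C u z" and xz: "sub_le C x z"
      using subobject_iff by auto
    obtain a where a: "a \<in> Hom C U (Dom C z)" "z \<cdot> a = u" using sub_leD[OF uz u zH] by blast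
    obtain b where b: "b \<in> Hom C X (Dom C z)" "z \<cdot> b = x" using sub_leD[OF xz x(1) zH] by blast
    obtain w where w: "is_cokernel C z w" using ex_cokernel HomD[OF zH] by blast
    define W where "W = Cod C w"
    have wH: "w \<in> Hom C L W" using cokernel_in_Hom[OF w zH] W_def by simp
    have wz: "w \<cdot> z = Zero C (Dom C z) W" using cokernel_Comp[OF w zH] W_def by simp
    have WO: "W \<in> Obj C" using HomD[OF wH] by blast
    have "w \<cdot> x = Zero C X W"
      using Comp_assoc[OF b(1) zH wH] b(2) wz Zero_Comp[OF b(1) WO] by simp
    then obtain v where v: "v \<in> Hom C E W" "v \<cdot> e = w"
      using cokernel_desc[OF e x(1) wH, folded E_def] by blast
    have "v \<cdot> (e \<cdot> u) = w \<cdot> u" using Comp_assoc[OF u eH v(1)] v(2) by simp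
    also have "\<dots> = Zero C U W"
      using Comp_assoc[OF a(1) zH wH] a(2) wz Zero_Comp[OF a(1) WO] by simp
    finally have "v = Zero C E W" using epic_Comp_eq_Zero[OF ep eu v(1)] by blast
    then have "w \<cdot> Id C L = Zero C L W"
      using v(2) Zero_Comp[OF eH WO] Comp_Id[OF wH] by simp
    then show "sub_le C (Id C L) z"
      using kernel_lift[OF monic_is_kernel_of_cokernel[OF zm zH w] wH I] sub_leI[OF _ I zH] W_def
      by metis
  qed
  moreover have "sub_eq C (Id C L) (Id C L)"
    unfolding sub_eq_def using sub_leI[OF I I I Id_Comp[OF I]] by blast
  ultimately show "\<exists>m. is_sum C L u x m \<and> sub_eq C m (Id C L)" by blast
qed

lemma kernel_top_iff:
  assumes e: "e \<in> Hom C L E" "epic C e" and x: "is_kernel C e x"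
  shows "sub_eq C x (Id C L) \<longleftrightarrow> zero_object C E"
proof -
  have O: "L \<in> Obj C" "E \<in> Obj C" using HomD[OF e(1)] by blast+
  note I = Id_in_Hom[OF O(1)]
  note xH = kernel_in_Hom[OF x e(1)]
  show ?thesis
  proof
    assume "sub_eq C x (Id C L)"
    then obtain j where j: "j \<in> Hom C L (Dom C x)" "x \<cdot> j = Id C L"
      using sub_leD[OF _ I xH] unfolding sub_eq_def by blast
    have "e = (e \<cdot> x) \<cdot> j" using Comp_assoc[OF j(1) xH e(1)] j(2) Comp_Id[OF e(1)] by simp
    also have "\<dots> = Zero C L E" using kernel_Comp[OF x e(1)] Zero_Comp[OF j(1) O(2)] by simp
    finally show "zero_object C E" using e(2) epic_Zero_iff[OF O] by simp
  next
    assume "zero_object C E"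
    then have "e \<cdot> Id C L = Zero C L E" using Comp_Id[OF e(1)] to_zero_object e(1) by simp
    then have "sub_le C (Id C L) x"
      using kernel_lift[OF x e(1) I] sub_leI[OF _ I xH] by metis
    then show "sub_eq C x (Id C L)"
      unfolding sub_eq_def using sub_leI[OF xH xH I Id_Comp[OF xH]] by blast
  qed
qed

text \<open>The description dual to that of essential kernels. A subobject \<open>x\<close> is replaced by the epic arrow
  \<open>e\<close> with kernel \<open>x\<close>; then \<open>u + x = L\<close> says that \<open>e \<cdot> u\<close> is epic, and \<open>x = L\<close> that \<open>e\<close> has zero codomain.\<close>

lemma superfluous_iff:
  assumes u: "subobject C L u"
  shows "superfluous C L u \<longleftrightarrow>
    (\<forall>E. \<forall>e\<in>Hom C L E. epic C e \<and> epic C (e \<cdot> u) \<longrightarrow> zero_object C E)"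
proof
  have uH: "u \<in> Hom C (Dom C u) L" using u subobject_iff by blast
  {
    assume s: "superfluous C L u"
    show "\<forall>E. \<forall>e\<in>Hom C L E. epic C e \<and> epic C (e \<cdot> u) \<longrightarrow> zero_object C E"
    proof (intro allI ballI impI)
      fix E e assume e: "e \<in> Hom C L E" and ep: "epic C e \<and> epic C (e \<cdot> u)"
      obtain x where x: "is_kernel C e x" using ex_kernel HomD[OF e] by blast
      note xH = kernel_in_Hom[OF x e] and xm = kernel_monic[OF x]
      have "is_cokernel C x e" using epic_is_cokernel_of_kernel[OF _ e x] ep by blast
      then have "\<exists>m. is_sum C L u x m \<and> sub_eq C m (Id C L)"
        using sum_top_iff[OF uH xH xm] ep by blast
      then have "sub_eq C x (Id C L)"
        using s kernel_subobject[OF x e] unfolding superfluous_def by blast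
      then show "zero_object C E" using kernel_top_iff[OF e _ x] ep by blast
    qed
  }
  assume *: "\<forall>E. \<forall>e\<in>Hom C L E. epic C e \<and> epic C (e \<cdot> u) \<longrightarrow> zero_object C E"
  show "superfluous C L u"
    unfolding superfluous_def
  proof (intro conjI allI impI u)
    fix x assume a: "subobject C L x \<and> (\<exists>m. is_sum C L u x m \<and> sub_eq C m (Id C L))"
    then have x: "x \<in> Hom C (Dom C x) L" "monic C x" using subobject_iff by blast+
    obtain e where e: "is_cokernel C x e" using ex_cokernel HomD[OF x(1)] by blast
    note eH = cokernel_in_Hom[OF e x(1)]
    have "epic C (e \<cdot> u)" using sum_top_iff[OF uH x e] a by blast
    then have "zero_object C (Cod C e)" using * eH cokernel_epic[OF e] by blast
    then show "sub_eq C x (Id C L)"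
      using kernel_top_iff[OF eH cokernel_epic[OF e] monic_is_kernel_of_cokernel[OF x(2,1) e]] by blast
  qed
qed

text \<open>Both sides speak about epic arrows \<open>e\<close> out of \<open>L\<close>, the left one about those with \<open>e \<cdot> u\<close> epic and
  the right one about those with \<open>e \<cdot> g\<close> epic. These are the same arrows: \<open>g\<close> factors through \<open>u\<close>, and an
  arrow that kills \<open>g\<close> factors through \<open>c\<close> and therefore kills \<open>u\<close>.\<close>

lemma superfluous_image_iff_essential_opposite:
  assumes g: "g \<in> Hom C P L" and c: "is_cokernel C g c" and u: "is_kernel C c u"
  shows "superfluous C L u \<longleftrightarrow> essential (opposite C) L c"
proof -
  note cH = cokernel_in_Hom[OF c g]
  note uH = kernel_in_Hom[OF u cH]
  obtain g' where g': "g' \<in> Hom C P (Dom C u)" "u \<cdot> g' = g"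
    using kernel_lift[OF u cH g] cokernel_Comp[OF c g] by blast
  have epic_iff: "epic C (e \<cdot> u) \<longleftrightarrow> epic C (e \<cdot> g)" if e: "e \<in> Hom C L E" for E e
  proof
    assume ep: "epic C (e \<cdot> u)"
    note eg = Comp_in_Hom[OF g e] and eu = Comp_in_Hom[OF uH e]
    show "epic C (e \<cdot> g)"
    proof (rule epicI[OF eg])
      fix X a assume a: "a \<in> Hom C E X" "a \<cdot> (e \<cdot> g) = Zero C P X"
      note ae = Comp_in_Hom[OF e a(1)]
      have "(a \<cdot> e) \<cdot> g = Zero C P X" using Comp_assoc[OF g e a(1)] a(2) by simp
      then obtain b where b: "b \<in> Hom C (Cod C c) X" "b \<cdot> c = a \<cdot> e"
        using cokernel_desc[OF c g ae] by blast
      have "a \<cdot> (e \<cdot> u) = b \<cdot> (c \<cdot> u)"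
        using Comp_assoc[OF uH e a(1)] Comp_assoc[OF uH cH b(1)] b(2) by simp
      also have "\<dots> = Zero C (Dom C u) X"
        using kernel_Comp[OF u cH] Comp_Zero[OF b(1)] HomD[OF uH] by simp
      finally show "a = Zero C E X" using epic_Comp_eq_Zero[OF ep eu a(1)] by blast
    qed
  next
    assume "epic C (e \<cdot> g)"
    then have "epic C ((e \<cdot> u) \<cdot> g')" using Comp_assoc[OF g'(1) uH e] g'(2) by simp
    then show "epic C (e \<cdot> u)"
      using category.monic_if_Comp_monic[OF category_opposite, of "e \<cdot> u" E "Dom C u" g' P]
        Comp_in_Hom[OF uH e] g'(1) by simp
  qed
  have "superfluous C L u \<longleftrightarrow>
      (\<forall>E. \<forall>e\<in>Hom C L E. epic C e \<and> epic C (e \<cdot> g) \<longrightarrow> zero_object C E)"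
    unfolding superfluous_iff[OF kernel_subobject[OF u cH]] using epic_iff by blast
  also have "\<dots> \<longleftrightarrow> essential (opposite C) L c"
    using abelian_category.essential_kernel_iff[OF abelian_category_opposite, of g L P c] g c by simp
  finally show ?thesis .
qed

text \<open>Write \<open>L\<close> for the image \<open>m\<close> of \<open>f\<close> and \<open>Q = N/L\<close>. A summand \<open>K\<close> of \<open>N\<close> inside \<open>L\<close> amounts to a retraction
  \<open>p : N \<rightarrow> N/K\<close> through which \<open>c : N \<rightarrow> Q\<close> factors, say as \<open>c = j \<cdot> p\<close>. Here \<open>j : N/K \<rightarrow> Q\<close> is the cokernel
  of \<open>p \<cdot> f\<close>, and its kernel is \<open>u : L/K \<rightarrow> N/K\<close>. Hence \<open>u\<close> is the image of \<open>p \<cdot> f\<close>, and by the previous lemma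
  it is superfluous iff \<open>j\<close> is essential in the opposite category.

  A splitting \<open>s\<close> of \<open>p\<close> makes it easy to identify \<open>L/K\<close> with the kernel of \<open>j\<close>: if \<open>j\<close> kills \<open>a\<close>, then \<open>c\<close>
  kills \<open>s \<cdot> a\<close>, which therefore lifts to \<open>L\<close>.\<close>

lemma lies_above_summand_iff_opposite:
  assumes f: "f \<in> Hom C M N" and c: "is_cokernel C f c" and m: "is_kernel C c m"
  shows "lies_above_summand C N m \<longleftrightarrow> essential_in_summand (opposite C) N c"
proof
  note cH = cokernel_in_Hom[OF c f]
  note mH = kernel_in_Hom[OF m cH]
  define L Q where "L = Dom C m" and "Q = Cod C c"
  have cH: "c \<in> Hom C N Q" and mH: "m \<in> Hom C L N" using cH mH by (simp_all add: L_def Q_def)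
  have cm: "c \<cdot> m = Zero C L Q" using kernel_Comp[OF m cH] by (simp add: L_def)
  have O: "L \<in> Obj C" "N \<in> Obj C" "Q \<in> Obj C" using HomD cH mH by blast+
  {
    assume "lies_above_summand C N m"
    then obtain k i q p u where k: "direct_summand C N k"
      and i: "i \<in> Hom C (Dom C k) L" "m \<cdot> i = k"
      and q: "is_cokernel C i q" and p: "is_cokernel C k p"
      and u: "u \<in> Hom C (Cod C q) (Cod C p)" "u \<cdot> q = p \<cdot> m"
      and su: "superfluous C (Cod C p) u"
      unfolding lies_above_summand_def L_def by blast
    define K D U where "K = Dom C k" and "D = Cod C p" and "U = Cod C q"
    have kH: "k \<in> Hom C K N" and ks: "is_section C k"
      using k unfolding direct_summand_def subobject_iff K_def by blast+
    have iH: "i \<in> Hom C K L" using i K_def by simp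
    have pH: "p \<in> Hom C N D" using cokernel_in_Hom[OF p kH] D_def by simp
    have qH: "q \<in> Hom C L U" using cokernel_in_Hom[OF q iH] U_def by simp
    have uH: "u \<in> Hom C U D" using u D_def U_def by simp
    have um: "monic C u" using su unfolding superfluous_def subobject_def by blast
    have DO: "D \<in> Obj C" using HomD pH by blast
    have pr: "is_retraction C p" using cokernel_of_section_is_retraction[OF kH ks p] .
    obtain s where s: "s \<in> Hom C D N" "p \<cdot> s = Id C D" using is_retractionD[OF pr pH] by blast
    have "c \<cdot> k = Zero C K Q"
      using Comp_assoc[OF iH mH cH] i(2) cm Zero_Comp[OF iH O(3)] by simp
    then obtain j where j: "j \<in> Hom C D Q" "j \<cdot> p = c"
      using cokernel_desc[OF p kH cH, folded D_def] by blast
    have jc: "is_cokernel C (p \<cdot> f) j"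
      using cokernel_through_epic[OF f pH j(1)] c j(2) cokernel_epic[OF p] by simp
    have "is_kernel C j u"
    proof (rule is_kernelI[OF j(1) uH um])
      have "(j \<cdot> u) \<cdot> q = (j \<cdot> p) \<cdot> m"
        using Comp_assoc[OF qH uH j(1)] Comp_assoc[OF mH pH j(1)] u(2) by simp
      then have "(j \<cdot> u) \<cdot> q = Zero C L Q" using j(2) cm by simp
      then show "j \<cdot> u = Zero C U Q"
        using epic_Comp_eq_Zero[OF cokernel_epic[OF q] qH Comp_in_Hom[OF uH j(1)]] by blast
      fix X a assume a: "a \<in> Hom C X D" "j \<cdot> a = Zero C X Q"
      note sa = Comp_in_Hom[OF a(1) s(1)]
      have psa: "p \<cdot> (s \<cdot> a) = a" using Comp_assoc[OF a(1) s(1) pH] s(2) Id_Comp[OF a(1)] by simp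
      have "c \<cdot> (s \<cdot> a) = Zero C X Q" using Comp_assoc[OF sa pH j(1)] j(2) psa a(2) by simp
      then obtain b where b: "b \<in> Hom C X L" "m \<cdot> b = s \<cdot> a"
        using kernel_lift[OF m cH sa, folded L_def] by blast
      have "u \<cdot> (q \<cdot> b) = p \<cdot> (m \<cdot> b)"
        using Comp_assoc[OF b(1) qH uH] Comp_assoc[OF b(1) mH pH] u(2) by simp
      then have "u \<cdot> (q \<cdot> b) = a" using b(2) psa by simp
      then show "\<exists>h\<in>Hom C X U. u \<cdot> h = a" using Comp_in_Hom[OF b(1) qH] by blast
    qed
    then have "essential (opposite C) D j"
      using superfluous_image_iff_essential_opposite[OF Comp_in_Hom[OF f pH] jc] su D_def by blast
    moreover have "Dom C c = N" "Dom C p = N" "j \<in> Hom C (Cod C p) (Cod C c)"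
      using HomD[OF cH] HomD[OF pH] j(1) by auto
    ultimately show "essential_in_summand (opposite C) N c"
      unfolding essential_in_summand_opposite_iff
      using pr cokernel_epic[OF p] cokernel_epic[OF c] j(2) D_def by blast
  }
  assume "essential_in_summand (opposite C) N c"
  then obtain d j where dr: "is_retraction C d" and de: "epic C d" "Dom C d = N"
    and j: "j \<in> Hom C (Cod C d) Q" "j \<cdot> d = c" and ej: "essential (opposite C) (Cod C d) j"
    unfolding essential_in_summand_opposite_iff Q_def by blast
  define D where "D = Cod C d"
  have dH: "d \<in> Hom C N D" using de by (auto simp: epic_def Hom_def D_def)
  have jH: "j \<in> Hom C D Q" using j D_def by simp
  have DO: "D \<in> Obj C" using HomD dH by blast
  obtain s where s: "s \<in> Hom C D N" "d \<cdot> s = Id C D" using is_retractionD[OF dr dH] by blast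
  obtain k where k: "is_kernel C d k" using ex_kernel HomD[OF dH] by blast
  define K where "K = Dom C k"
  have kH: "k \<in> Hom C K N" using kernel_in_Hom[OF k dH] K_def by simp
  have KO: "K \<in> Obj C" using HomD kH by blast
  have dk: "d \<cdot> k = Zero C K D" using kernel_Comp[OF k dH] K_def by simp
  have pk: "is_cokernel C k d" using epic_is_cokernel_of_kernel[OF de(1) dH k] .
  have ks: "direct_summand C N k"
    unfolding direct_summand_def
    using kernel_subobject[OF k dH] kernel_of_retraction_is_section[OF dH dr k] by blast
  have "c \<cdot> k = Zero C K Q"
    using Comp_assoc[OF kH dH jH] j(2) dk Comp_Zero[OF jH KO] by simp
  then obtain i where i: "i \<in> Hom C K L" "m \<cdot> i = k"
    using kernel_lift[OF m cH kH, folded L_def] by blast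
  have jc: "is_cokernel C (d \<cdot> f) j"
    using cokernel_through_epic[OF f dH jH] c j(2) de(1) by simp
  \<comment> \<open>The inclusion \<open>L/K \<rightarrow> N/K\<close> is taken to be the kernel of \<open>j\<close>, which makes it monic at once. What is
    left to prove is that the arrow \<open>q\<close> from \<open>L\<close> to its domain is the cokernel of \<open>K \<rightarrow> L\<close>: it is
    split by \<open>b\<close>, hence epic, and its kernel is \<open>K\<close>.\<close>
  obtain u where u: "is_kernel C j u" using ex_kernel HomD[OF jH] by blast
  define U where "U = Dom C u"
  have uH: "u \<in> Hom C U D" using kernel_in_Hom[OF u jH] U_def by simp
  have UO: "U \<in> Obj C" using HomD uH by blast
  have ju: "j \<cdot> u = Zero C U Q" using kernel_Comp[OF u jH] U_def by simp
  have um: "monic C u" using kernel_monic[OF u] .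
  note dm = Comp_in_Hom[OF mH dH]
  have "j \<cdot> (d \<cdot> m) = Zero C L Q" using Comp_assoc[OF mH dH jH] j(2) cm by simp
  then obtain q where q: "q \<in> Hom C L U" "u \<cdot> q = d \<cdot> m"
    using kernel_lift[OF u jH dm, folded U_def] by blast
  note su = Comp_in_Hom[OF uH s(1)]
  have dsu: "d \<cdot> (s \<cdot> u) = u" using Comp_assoc[OF uH s(1) dH] s(2) Id_Comp[OF uH] by simp
  have "c \<cdot> (s \<cdot> u) = Zero C U Q" using Comp_assoc[OF su dH jH] j(2) dsu ju by simp
  then obtain b where b: "b \<in> Hom C U L" "m \<cdot> b = s \<cdot> u"
    using kernel_lift[OF m cH su, folded L_def] by blast
  have "u \<cdot> (q \<cdot> b) = d \<cdot> (m \<cdot> b)"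
    using Comp_assoc[OF b(1) q(1) uH] Comp_assoc[OF b(1) mH dH] q(2) by simp
  then have "u \<cdot> (q \<cdot> b) = u \<cdot> Id C U" using b(2) dsu Comp_Id[OF uH] by simp
  then have qb: "q \<cdot> b = Id C U"
    using monicD[OF um uH Comp_in_Hom[OF b(1) q(1)] Id_in_Hom[OF UO]] by blast
  have "is_kernel C q i"
  proof (rule is_kernelI[OF q(1) i(1)])
    show "monic C i" using monic_if_Comp_monic[OF i(1) mH] i(2) kernel_monic[OF k] by simp
    have "u \<cdot> (q \<cdot> i) = d \<cdot> (m \<cdot> i)"
      using Comp_assoc[OF i(1) q(1) uH] Comp_assoc[OF i(1) mH dH] q(2) by simp
    then have "u \<cdot> (q \<cdot> i) = Zero C K D" using i(2) dk by simp
    then show "q \<cdot> i = Zero C K U"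
      using monic_Comp_eq_Zero[OF um uH Comp_in_Hom[OF i(1) q(1)]] by blast
    fix X a assume a: "a \<in> Hom C X L" "q \<cdot> a = Zero C X U"
    note ma = Comp_in_Hom[OF a(1) mH]
    have "d \<cdot> (m \<cdot> a) = u \<cdot> (q \<cdot> a)"
      using Comp_assoc[OF a(1) q(1) uH] Comp_assoc[OF a(1) mH dH] q(2) by simp
    also have "\<dots> = Zero C X D" using a(2) Comp_Zero[OF uH] HomD[OF a(1)] by simp
    finally obtain y where y: "y \<in> Hom C X K" "k \<cdot> y = m \<cdot> a"
      using kernel_lift[OF k dH ma, folded K_def] by blast
    have "m \<cdot> (i \<cdot> y) = m \<cdot> a" using Comp_assoc[OF y(1) i(1) mH] i(2) y(2) by simp
    then have "i \<cdot> y = a"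
      using monicD[OF kernel_monic[OF m] mH Comp_in_Hom[OF y(1) i(1)] a(1)] by blast
    then show "\<exists>h\<in>Hom C X K. i \<cdot> h = a" using y by blast
  qed
  then have qc: "is_cokernel C i q"
    using epic_is_cokernel_of_kernel[OF retraction_epic[OF q(1) b(1) qb] q(1)] by blast
  have "superfluous C D u"
    using superfluous_image_iff_essential_opposite[OF Comp_in_Hom[OF f dH] jc u] ej D_def by blast
  moreover have "u \<in> Hom C (Cod C q) (Cod C d)" using uH HomD[OF q(1)] D_def by simp
  ultimately show "lies_above_summand C N m"
    unfolding lies_above_summand_def
    using kernel_subobject[OF m cH] ks i[unfolded K_def L_def] qc pk q(2)
    by (intro conjI exI[of _ k] exI[of _ i] exI[of _ q] exI[of _ d] exI[of _ u]) (simp_all add: D_def)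
qed

section \<open>Rickart and CS-Rickart objects\<close>

text \<open>The identity is the kernel of the zero arrow, which is monic only on zero subobjects.\<close>

lemma essential_Id:
  assumes "L \<in> Obj C" shows "essential C L (Id C L)"
proof -
  note I = Id_in_Hom[OF assms] and z = Zero_in_Hom[OF assms assms]
  have "is_kernel C (Zero C L L) (Id C L)"
    using is_kernelI[OF z I monic_Id[OF assms] Comp_Id[OF z]] Id_Comp by blast
  moreover have "zero_object C X" if x: "x \<in> Hom C X L" and "monic C (Zero C L L \<cdot> x)" for X x
    using that Zero_Comp[OF x assms] monic_Zero_iff[OF _ assms] HomD[OF x] by simp
  ultimately show ?thesis using essential_kernel_iff[OF z] by blast
qed

lemma rickart_imp_CS_rickart:
  assumes "rickart C M N"
  shows "CS_rickart C M N"
  unfolding CS_rickart_def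
proof (intro ballI allI impI)
  fix f k assume f: "f \<in> Hom C M N" and k: "is_kernel C f k"
  have kH: "k \<in> Hom C (Dom C k) M" using kernel_in_Hom[OF k f] .
  have "direct_summand C M k"
    using assms f k kernel_subobject[OF k f] unfolding rickart_def direct_summand_def by blast
  then show "essential_in_summand C M k"
    unfolding essential_in_summand_def
    using kernel_subobject[OF k f] Id_in_Hom Comp_Id[OF kH] essential_Id HomD[OF kH] by blast
qed

text \<open>Let \<open>r\<close> be a retraction of \<open>k\<close>. The complement \<open>x\<close> of \<open>k\<close>, which is the kernel of \<open>r\<close>, meets \<open>k\<close>
  trivially, so it is zero when \<open>k\<close> is essential. Then \<open>r\<close> is monic and \<open>k\<close> is an isomorphism, so \<open>f \<cdot> k = 0\<close>
  forces \<open>f = 0\<close>.\<close>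

lemma rickart_imp_K_nonsingular:
  assumes "rickart C M N"
  shows "K_nonsingular C M N"
  unfolding K_nonsingular_def
proof (intro ballI allI impI)
  fix f k assume f: "f \<in> Hom C M N" and "is_kernel C f k \<and> essential C M k"
  then have k: "is_kernel C f k" and ek: "essential C M k" by auto
  define K where "K = Dom C k"
  have kH: "k \<in> Hom C K M" using kernel_in_Hom[OF k f] K_def by simp
  obtain r where r: "r \<in> Hom C M K" "r \<cdot> k = Id C K"
    using assms f k is_sectionD[OF _ kH] unfolding rickart_def by blast
  obtain x where x: "is_kernel C r x" using ex_kernel HomD[OF r(1)] by blast
  define X where "X = Dom C x"
  have xH: "x \<in> Hom C X M" using kernel_in_Hom[OF x r(1)] X_def by simp
  have rx: "r \<cdot> x = Zero C X K" using kernel_Comp[OF x r(1)] X_def by simp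
  have fk: "f \<cdot> k = Zero C K N" using kernel_Comp[OF k f] K_def by simp
  have O: "K \<in> Obj C" "X \<in> Obj C" "M \<in> Obj C" "N \<in> Obj C" using HomD kH xH f by blast+
  have "monic C (f \<cdot> x)"
  proof (rule monicI[OF Comp_in_Hom[OF xH f]])
    fix Y a assume a: "a \<in> Hom C Y X" "(f \<cdot> x) \<cdot> a = Zero C Y N"
    have YO: "Y \<in> Obj C" using HomD a by blast
    note xa = Comp_in_Hom[OF a(1) xH]
    have "f \<cdot> (x \<cdot> a) = Zero C Y N" using a(2) Comp_assoc[OF a(1) xH f] by simp
    then obtain b where b: "b \<in> Hom C Y K" "k \<cdot> b = x \<cdot> a"
      using kernel_lift[OF k f xa, folded K_def] by blast
    have "b = r \<cdot> (x \<cdot> a)"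
      using Comp_assoc[OF b(1) kH r(1)] r(2) Id_Comp[OF b(1)] b(2) by simp
    also have "\<dots> = Zero C Y K"
      using Comp_assoc[OF a(1) xH r(1)] rx Zero_Comp[OF a(1) O(1)] by simp
    finally have "x \<cdot> a = Zero C Y M" using b(2) Comp_Zero[OF kH YO] by simp
    then show "a = Zero C Y X" using monic_Comp_eq_Zero[OF kernel_monic[OF x] xH a(1)] by blast
  qed
  then have "zero_object C X"
    using ek essential_kernel_iff[OF f k] xH kernel_monic[OF x] by blast
  then have x0: "x = Zero C X M" using from_zero_object xH by blast
  have "monic C r"
  proof (rule monicI[OF r(1)])
    fix Y a assume a: "a \<in> Hom C Y M" "r \<cdot> a = Zero C Y K"
    then obtain b where "b \<in> Hom C Y X" "x \<cdot> b = a" using kernel_lift[OF x r(1) a, folded X_def] by blast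
    then show "a = Zero C Y M" using x0 Zero_Comp O(3) by blast
  qed
  moreover have "r \<cdot> (k \<cdot> r) = r \<cdot> Id C M"
    using Comp_assoc[OF r(1) kH r(1)] r(2) Id_Comp[OF r(1)] Comp_Id[OF r(1)] by simp
  ultimately have "k \<cdot> r = Id C M"
    using monicD[OF _ r(1) Comp_in_Hom[OF r(1) kH] Id_in_Hom[OF O(3)]] by blast
  then have "f = (f \<cdot> k) \<cdot> r" using Comp_assoc[OF r(1) kH f] Comp_Id[OF f] by simp
  then show "f = Zero C M N" using fk Zero_Comp[OF r(1) O(4)] by simp
qed

text \<open>The nonsingularity assumption is applied to the arrow \<open>f' = f \<cdot> d \<cdot> r\<close>, which agrees with \<open>f\<close> on the
  summand \<open>d\<close> and is zero on its complement. Its kernel is essential, because \<open>r\<close> maps any \<open>x\<close> on which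
  \<open>f'\<close> is monic isomorphically to a subobject of \<open>Dom d\<close> that meets \<open>j\<close> trivially.\<close>

lemma CS_rickart_K_nonsingular_imp_rickart:
  assumes CS: "CS_rickart C M N" and K: "K_nonsingular C M N"
  shows "rickart C M N"
  unfolding rickart_def
proof (intro ballI allI impI)
  fix f k assume f: "f \<in> Hom C M N" and k: "is_kernel C f k"
  define K where "K = Dom C k"
  have kH: "k \<in> Hom C K M" using kernel_in_Hom[OF k f] K_def by simp
  obtain d j where ds: "direct_summand C M d" and j: "j \<in> Hom C K (Dom C d)" "d \<cdot> j = k"
    and ej: "essential C (Dom C d) j"
    using CS f k unfolding CS_rickart_def essential_in_summand_def K_def by blast
  define D where "D = Dom C d"
  have dH: "d \<in> Hom C D M" and dm: "monic C d" and dsec: "is_section C d"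
    using ds unfolding direct_summand_def subobject_iff D_def by blast+
  have jH: "j \<in> Hom C K D" using j D_def by simp
  obtain r where r: "r \<in> Hom C M D" "r \<cdot> d = Id C D" using is_sectionD[OF dsec dH] by blast
  note fd = Comp_in_Hom[OF dH f]
  have jk: "is_kernel C (f \<cdot> d) j"
    using kernel_through_monic[OF f dH jH] k j(2) dm by simp
  define f' where "f' = (f \<cdot> d) \<cdot> r"
  have f': "f' \<in> Hom C M N" using Comp_in_Hom[OF r(1) fd] f'_def by simp
  obtain k' where k': "is_kernel C f' k'" using ex_kernel HomD[OF f'] by blast
  have "zero_object C X"
    if x: "x \<in> Hom C X M" and mo: "monic C (f' \<cdot> x)" for X x
  proof -
    note rx = Comp_in_Hom[OF x r(1)]
    have "monic C ((f \<cdot> d) \<cdot> (r \<cdot> x))" using mo Comp_assoc[OF x r(1) fd] f'_def by simp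
    moreover from this have "monic C (r \<cdot> x)" using monic_if_Comp_monic[OF rx fd] by blast
    ultimately show ?thesis using ej essential_kernel_iff[OF fd jk] rx D_def by blast
  qed
  then have "essential C M k'" using essential_kernel_iff[OF f' k'] by blast
  then have "f' = Zero C M N" using K f' k' unfolding K_nonsingular_def by blast
  then have "f \<cdot> d = Zero C D N"
    using Comp_assoc[OF dH r(1) fd] r(2) Comp_Id[OF fd] f'_def Zero_Comp[OF dH] HomD[OF f] by simp
  then obtain h where h: "h \<in> Hom C D K" "k \<cdot> h = d"
    using kernel_lift[OF k f dH, folded K_def] by blast
  have "k \<cdot> (h \<cdot> j) = k \<cdot> Id C K"
    using Comp_assoc[OF jH h(1) kH] h(2) j(2) Comp_Id[OF kH] by simp
  then have hj: "h \<cdot> j = Id C K"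
    using monicD[OF kernel_monic[OF k] kH Comp_in_Hom[OF jH h(1)]] Id_in_Hom HomD[OF kH] by blast
  have "r \<cdot> k = j" using Comp_assoc[OF jH dH r(1)] j(2) r(2) Id_Comp[OF jH] by simp
  then have "(h \<cdot> r) \<cdot> k = Id C K" using Comp_assoc[OF kH r(1) h(1)] hj by simp
  then show "is_section C k" using is_sectionI[OF kH Comp_in_Hom[OF r(1) h(1)]] by blast
qed

lemma CS_rickart_and_K_nonsingular_iff_rickart:
  "CS_rickart C M N \<and> K_nonsingular C M N \<longleftrightarrow> rickart C M N"
  using rickart_imp_CS_rickart rickart_imp_K_nonsingular CS_rickart_K_nonsingular_imp_rickart
  by blast

lemma ex_kernel_of_cokernel: "is_cokernel C f c \<Longrightarrow> \<exists>m. is_kernel C c m"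
  using ex_kernel unfolding is_cokernel_def by blast

lemma dual_CS_rickart_iff_opposite: "dual_CS_rickart C M N \<longleftrightarrow> CS_rickart (opposite C) N M"
proof -
  have "(\<forall>m. is_image C f m \<longrightarrow> lies_above_summand C N m) \<longleftrightarrow>
      (\<forall>c. is_cokernel C f c \<longrightarrow> essential_in_summand (opposite C) N c)" if f: "f \<in> Hom C M N" for f
    unfolding is_image_def using lies_above_summand_iff_opposite[OF f] ex_kernel_of_cokernel by blast
  then show ?thesis
    unfolding dual_CS_rickart_def CS_rickart_def Hom_opposite is_kernel_opposite by blast
qed

lemma T_nonsingular_iff_opposite: "T_nonsingular C M N \<longleftrightarrow> K_nonsingular (opposite C) N M"
proof -
  have "(\<exists>m. is_image C f m \<and> superfluous C N m) \<longleftrightarrow>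
      (\<exists>c. is_cokernel C f c \<and> essential (opposite C) N c)" if f: "f \<in> Hom C M N" for f
    unfolding is_image_def
    using superfluous_image_iff_essential_opposite[OF f] ex_kernel_of_cokernel by blast
  then show ?thesis
    unfolding T_nonsingular_def K_nonsingular_def Hom_opposite is_kernel_opposite opposite_simps
    by blast
qed

lemma dual_rickart_iff_opposite: "dual_rickart C M N \<longleftrightarrow> rickart (opposite C) N M"
  by (simp add: dual_rickart_def rickart_def)

end

theorem theorem2p11:
  fixes C :: "('o, 'a, 'b) precat_scheme" and M N :: 'o
  assumes "abelian_category C" and "M \<in> Obj C" and "N \<in> Obj C"
  shows "(CS_rickart C M N \<and> K_nonsingular C M N \<longleftrightarrow> rickart C M N) \<and>
         (dual_CS_rickart C M N \<and> T_nonsingular C M N \<longleftrightarrow> dual_rickart C M N)"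
proof -
  interpret abelian_category C by fact
  show ?thesis
    unfolding dual_CS_rickart_iff_opposite T_nonsingular_iff_opposite dual_rickart_iff_opposite
    using CS_rickart_and_K_nonsingular_iff_rickart
      abelian_category.CS_rickart_and_K_nonsingular_iff_rickart[OF abelian_category_opposite]
    by blast
qed

end
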